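(* Let $\mathbb K=(G,M,I)$ be a context. Then $(\mathtt{SC}^{left}/\!\equiv^{left},\wedge,\neg,[(\bot_{s_1},\boxminus_{\mathfrak o}\bot_{s_1})])$ and $(\mathtt{SC}^{right}/\!\equiv^{right},\vee,\neg,[(\boxminus_{\mathfrak p}\bot_{s_2},\bot_{s_2})])$ are both Boolean algebras, where in the first structure $\wedge$ is the meet, $\neg$ the complement and the constant is the least element, and in the second $\vee$ is the join, $\neg$ the complement and the constant is the greatest element (the remaining lattice operation being obtained by De Morgan duality).
   Context: Language. There are two sorts $s_1,s_2$, with disjoint nonempty sets of propositional variables $P_{s_1},P_{s_2}$. $\mathrm{Fm}_1$ (sort $s_1$) and $\mathrm{Fm}_2$ (sort $s_2$) are defined by simultaneous induction: $\varphi ::= p\mid \neg\varphi\mid\varphi\wedge\varphi\mid \Box_{\mathfrak p}\psi\mid \boxminus_{\mathfrak p}\psi$ ($p\in P_{s_1}$, $\psi\in\mathrm{Fm}_2$) and $\psi::= q\mid\neg\psi\mid\psi\wedge\psi\mid\Box_{\mathfrak o}\varphi\mid\boxminus_{\mathfrak o}\varphi$ ($q\in P_{s_2}$, $\varphi\in\mathrm{Fm}_1$). Other Boolean connectives are the usual abbreviations; $\bot_{s_i}$ is falsum of sort $s_i$. Semantics. A context is $\mathbb K=(G,M,I)$ with $G,M$ sets and $I\subseteq G\times M$. A $\mathbb K$-based model is $\mathfrak M=(G,M,I,v)$, where $v$ assigns to each $p\in P_{s_1}$ a subset of $G$ and to each $q\in P_{s_2}$ a subset of $M$. Sort-$s_1$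 formulas are evaluated at $g\in G$, sort-$s_2$ formulas at $m\in M$: variables by $v$, Boolean connectives classically, and: $g\models\Box_{\mathfrak p}\psi$ iff for all $m$, $Igm$ implies $m\models\psi$; $m\models\Box_{\mathfrak o}\varphi$ iff for all $g$, $Igm$ implies $g\models\varphi$; $g\models\boxminus_{\mathfrak p}\psi$ iff for all $m$, $m\models\psi$ implies $Igm$; $m\models\boxminus_{\mathfrak o}\varphi$ iff for all $g$, $g\models\varphi$ implies $Igm$. Write $\models^{\mathfrak C_{\mathbb K}}_{s_i}\chi$ if the sort-$s_i$ formula $\chi$ holds at all points of sort $s_i$ in all $\mathbb K$-based models. Semiconcepts. A pair $(\varphi,\psi)\in\mathrm{Fm}_1\times\mathrm{Fm}_2$ is a left semiconcept if $\models^{\mathfrak C_{\mathbb K}}_{s_2}\boxminus_{\mathfrak o}\varphi\leftrightarrow\psi$, and a right semiconcept if $\models^{\mathfrak C_{\mathbb K}}_{s_1}\varphi\leftrightarrow\boxminus_{\mathfrak p}\psi$; the sets of these are $\mathtt{SC}^{left}$ and $\mathtt{SC}^{right}$. On $\mathtt{SC}^{left}$, $(\varphi_1,\psi_1)\equiv^{left}(\varphi_2,\psi_2)$ iff $\models^{\mathfrak C_{\mathbb K}}_{s_1}\varphi_1\leftrightarrow\varphi_2$; on $\mathtt{SC}^{right}$, $(\varphi_1,\psi_1)\equiv^{right}(\varphi_2,\psi_2)$ iff $\models^{\mathfrak C_{\mathbb K}}_{s_2}\psi_1\leftrightarrow\psi_2$. $[\cdot]$ denotes equivalence classes. On $\mathtt{SC}^{left}/\!\equiv^{left}$: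 $[(\varphi,\psi)]\wedge[(\varphi',\psi')]:=[(\varphi\wedge\varphi',\boxminus_{\mathfrak o}(\varphi\wedge\varphi'))]$, $\neg[(\varphi,\psi)]:=[(\neg\varphi,\boxminus_{\mathfrak o}\neg\varphi)]$. On $\mathtt{SC}^{right}/\!\equiv^{right}$: $[(\varphi,\psi)]\vee[(\varphi',\psi')]:=[(\boxminus_{\mathfrak p}(\psi\wedge\psi'),\psi\wedge\psi')]$, $\neg[(\varphi,\psi)]:=[(\boxminus_{\mathfrak p}\neg\psi,\neg\psi)]$. *)

theory Defs
  imports Main
begin

section \<open>Two-sorted language\<close>

text \<open>The disjoint nonempty sets of variables of the two sorts are the types \<open>'p\<close> and \<open>'q\<close>.
  \<open>Box_p\<close>, \<open>WBox_p\<close> and \<open>Box_o\<close>, \<open>WBox_o\<close> are the modalities \<open>\<box>\<close>, \<open>\<boxminus>\<close> with index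
  \<open>p\<close> (taking sort 2 to sort 1) and \<open>o\<close> (taking sort 1 to sort 2).\<close>

datatype ('p, 'q) fm1 =
    Var1 'p | Neg1 "('p, 'q) fm1" | And1 "('p, 'q) fm1" "('p, 'q) fm1"
  | Box_p "('p, 'q) fm2" | WBox_p "('p, 'q) fm2"
and ('p, 'q) fm2 =
    Var2 'q | Neg2 "('p, 'q) fm2" | And2 "('p, 'q) fm2" "('p, 'q) fm2"
  | Box_o "('p, 'q) fm1" | WBox_o "('p, 'q) fm1"

abbreviation Imp1 :: "('p, 'q) fm1 \<Rightarrow> ('p, 'q) fm1 \<Rightarrow> ('p, 'q) fm1" where
  "Imp1 \<phi> \<chi> \<equiv> Neg1 (And1 \<phi> (Neg1 \<chi>))"

abbreviation Imp2 :: "('p, 'q) fm2 \<Rightarrow> ('p, 'q) fm2 \<Rightarrow> ('p, 'q) fm2" where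
  "Imp2 \<psi> \<chi> \<equiv> Neg2 (And2 \<psi> (Neg2 \<chi>))"

abbreviation Iff1 :: "('p, 'q) fm1 \<Rightarrow> ('p, 'q) fm1 \<Rightarrow> ('p, 'q) fm1" where
  "Iff1 \<phi> \<chi> \<equiv> And1 (Imp1 \<phi> \<chi>) (Imp1 \<chi> \<phi>)"

abbreviation Iff2 :: "('p, 'q) fm2 \<Rightarrow> ('p, 'q) fm2 \<Rightarrow> ('p, 'q) fm2" where
  "Iff2 \<psi> \<chi> \<equiv> And2 (Imp2 \<psi> \<chi>) (Imp2 \<chi> \<psi>)"

text \<open>Falsum is not primitive: it abbreviates \<open>p \<and> \<not> p\<close> for an arbitrary fixed variable of
  the sort.\<close>

definition Bot1 :: "('p, 'q) fm1" where
  "Bot1 = And1 (Var1 (SOME p. True)) (Neg1 (Var1 (SOME p. True)))"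

definition Bot2 :: "('p, 'q) fm2" where
  "Bot2 = And2 (Var2 (SOME q. True)) (Neg2 (Var2 (SOME q. True)))"


section \<open>Contexts and models\<close>

record ('g, 'm) fcontext =
  Obj :: "'g set"
  Att :: "'m set"
  Inc :: "('g \<times> 'm) set"

definition is_fcontext :: "('g, 'm) fcontext \<Rightarrow> bool" where
  "is_fcontext K \<longleftrightarrow> Inc K \<subseteq> Obj K \<times> Att K"

text \<open>The valuation of a model is given by its restrictions \<open>v\<close>, \<open>w\<close> to the variables of the
  two sorts.\<close>

definition valuation :: "('g, 'm) fcontext \<Rightarrow> ('p \<Rightarrow> 'g set) \<Rightarrow> ('q \<Rightarrow> 'm set) \<Rightarrow> bool" where
  "valuation K v w \<longleftrightarrow> (\<forall>p. v p \<subseteq> Obj K) \<and> (\<forall>q. w q \<subseteq> Att K)"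

primrec
  sat1 :: "('g, 'm) fcontext \<Rightarrow> ('p \<Rightarrow> 'g set) \<Rightarrow> ('q \<Rightarrow> 'm set) \<Rightarrow> ('p, 'q) fm1 \<Rightarrow> 'g \<Rightarrow> bool"
and
  sat2 :: "('g, 'm) fcontext \<Rightarrow> ('p \<Rightarrow> 'g set) \<Rightarrow> ('q \<Rightarrow> 'm set) \<Rightarrow> ('p, 'q) fm2 \<Rightarrow> 'm \<Rightarrow> bool"
where
  "sat1 K v w (Var1 p) = (\<lambda>g. g \<in> v p)"
| "sat1 K v w (Neg1 \<phi>) = (\<lambda>g. \<not> sat1 K v w \<phi> g)"
| "sat1 K v w (And1 \<phi> \<chi>) = (\<lambda>g. sat1 K v w \<phi> g \<and> sat1 K v w \<chi> g)"
| "sat1 K v w (Box_p \<psi>) = (\<lambda>g. \<forall>m\<in>Att K. (g, m) \<in> Inc K \<longrightarrow> sat2 K v w \<psi> m)"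
| "sat1 K v w (WBox_p \<psi>) = (\<lambda>g. \<forall>m\<in>Att K. sat2 K v w \<psi> m \<longrightarrow> (g, m) \<in> Inc K)"
| "sat2 K v w (Var2 q) = (\<lambda>m. m \<in> w q)"
| "sat2 K v w (Neg2 \<psi>) = (\<lambda>m. \<not> sat2 K v w \<psi> m)"
| "sat2 K v w (And2 \<psi> \<chi>) = (\<lambda>m. sat2 K v w \<psi> m \<and> sat2 K v w \<chi> m)"
| "sat2 K v w (Box_o \<phi>) = (\<lambda>m. \<forall>g\<in>Obj K. (g, m) \<in> Inc K \<longrightarrow> sat1 K v w \<phi> g)"
| "sat2 K v w (WBox_o \<phi>) = (\<lambda>m. \<forall>g\<in>Obj K. sat1 K v w \<phi> g \<longrightarrow> (g, m) \<in> Inc K)"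

definition valid1 :: "('g, 'm) fcontext \<Rightarrow> ('p, 'q) fm1 \<Rightarrow> bool" where
  "valid1 K \<phi> \<longleftrightarrow> (\<forall>v w. valuation K v w \<longrightarrow> (\<forall>g\<in>Obj K. sat1 K v w \<phi> g))"

definition valid2 :: "('g, 'm) fcontext \<Rightarrow> ('p, 'q) fm2 \<Rightarrow> bool" where
  "valid2 K \<psi> \<longleftrightarrow> (\<forall>v w. valuation K v w \<longrightarrow> (\<forall>m\<in>Att K. sat2 K v w \<psi> m))"


section \<open>Semiconcepts and their quotients\<close>

definition SC_left :: "('g, 'm) fcontext \<Rightarrow> (('p, 'q) fm1 \<times> ('p, 'q) fm2) set" where
  "SC_left K = {(\<phi>, \<psi>). valid2 K (Iff2 (WBox_o \<phi>) \<psi>)}"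

definition SC_right :: "('g, 'm) fcontext \<Rightarrow> (('p, 'q) fm1 \<times> ('p, 'q) fm2) set" where
  "SC_right K = {(\<phi>, \<psi>). valid1 K (Iff1 \<phi> (WBox_p \<psi>))}"

definition eq_left :: "('g, 'm) fcontext \<Rightarrow> (('p, 'q) fm1 \<times> ('p, 'q) fm2) rel" where
  "eq_left K = {((\<phi>1, \<psi>1), (\<phi>2, \<psi>2)).
     (\<phi>1, \<psi>1) \<in> SC_left K \<and> (\<phi>2, \<psi>2) \<in> SC_left K \<and> valid1 K (Iff1 \<phi>1 \<phi>2)}"

definition eq_right :: "('g, 'm) fcontext \<Rightarrow> (('p, 'q) fm1 \<times> ('p, 'q) fm2) rel" where
  "eq_right K = {((\<phi>1, \<psi>1), (\<phi>2, \<psi>2)).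
     (\<phi>1, \<psi>1) \<in> SC_right K \<and> (\<phi>2, \<psi>2) \<in> SC_right K \<and> valid2 K (Iff2 \<psi>1 \<psi>2)}"

definition cls_left ::
  "('g, 'm) fcontext \<Rightarrow> ('p, 'q) fm1 \<times> ('p, 'q) fm2 \<Rightarrow> (('p, 'q) fm1 \<times> ('p, 'q) fm2) set" where
  "cls_left K x = eq_left K `` {x}"

definition cls_right ::
  "('g, 'm) fcontext \<Rightarrow> ('p, 'q) fm1 \<times> ('p, 'q) fm2 \<Rightarrow> (('p, 'q) fm1 \<times> ('p, 'q) fm2) set" where
  "cls_right K x = eq_right K `` {x}"

text \<open>Operations on classes are the unions of the result classes over all representatives;
  \<open>meet_left_cls\<close> etc. below show that they are independent of the representatives and so satisfy
  the usual defining equations.\<close>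

definition meet_left ::
  "('g, 'm) fcontext \<Rightarrow> (('p, 'q) fm1 \<times> ('p, 'q) fm2) set \<Rightarrow> (('p, 'q) fm1 \<times> ('p, 'q) fm2) set
    \<Rightarrow> (('p, 'q) fm1 \<times> ('p, 'q) fm2) set" where
  "meet_left K X Y =
     (\<Union>(\<phi>, \<psi>)\<in>X. \<Union>(\<phi>', \<psi>')\<in>Y. cls_left K (And1 \<phi> \<phi>', WBox_o (And1 \<phi> \<phi>')))"

definition neg_left ::
  "('g, 'm) fcontext \<Rightarrow> (('p, 'q) fm1 \<times> ('p, 'q) fm2) set
    \<Rightarrow> (('p, 'q) fm1 \<times> ('p, 'q) fm2) set" where
  "neg_left K X = (\<Union>(\<phi>, \<psi>)\<in>X. cls_left K (Neg1 \<phi>, WBox_o (Neg1 \<phi>)))"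

definition bot_left :: "('g, 'm) fcontext \<Rightarrow> (('p, 'q) fm1 \<times> ('p, 'q) fm2) set" where
  "bot_left K = cls_left K (Bot1, WBox_o Bot1)"

definition join_right ::
  "('g, 'm) fcontext \<Rightarrow> (('p, 'q) fm1 \<times> ('p, 'q) fm2) set \<Rightarrow> (('p, 'q) fm1 \<times> ('p, 'q) fm2) set
    \<Rightarrow> (('p, 'q) fm1 \<times> ('p, 'q) fm2) set" where
  "join_right K X Y =
     (\<Union>(\<phi>, \<psi>)\<in>X. \<Union>(\<phi>', \<psi>')\<in>Y. cls_right K (WBox_p (And2 \<psi> \<psi>'), And2 \<psi> \<psi>'))"

definition neg_right ::
  "('g, 'm) fcontext \<Rightarrow> (('p, 'q) fm1 \<times> ('p, 'q) fm2) set
    \<Rightarrow> (('p, 'q) fm1 \<times> ('p, 'q) fm2) set" where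
  "neg_right K X = (\<Union>(\<phi>, \<psi>)\<in>X. cls_right K (WBox_p (Neg2 \<psi>), Neg2 \<psi>))"

definition top_right :: "('g, 'm) fcontext \<Rightarrow> (('p, 'q) fm1 \<times> ('p, 'q) fm2) set" where
  "top_right K = cls_right K (WBox_p Bot2, Bot2)"

lemma valid1_Iff1:
  "valid1 K (Iff1 a b) \<longleftrightarrow>
    (\<forall>v w. valuation K v w \<longrightarrow> (\<forall>x\<in>Obj K. sat1 K v w a x \<longleftrightarrow> sat1 K v w b x))"
proof -
  have "sat1 K v w (Iff1 a b) x \<longleftrightarrow> (sat1 K v w a x \<longleftrightarrow> sat1 K v w b x)" for v w x
    by simp blast
  then show ?thesis
    unfolding valid1_def by presburger
qed

lemma valid2_Iff2:
  "valid2 K (Iff2 a b) \<longleftrightarrow>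
    (\<forall>v w. valuation K v w \<longrightarrow> (\<forall>x\<in>Att K. sat2 K v w a x \<longleftrightarrow> sat2 K v w b x))"
proof -
  have "sat2 K v w (Iff2 a b) x \<longleftrightarrow> (sat2 K v w a x \<longleftrightarrow> sat2 K v w b x)" for v w x
    by simp blast
  then show ?thesis
    unfolding valid2_def by presburger
qed

lemma equiv_eq_left: "equiv (SC_left K) (eq_left K)"
proof (rule equivI)
  show "eq_left K \<subseteq> SC_left K \<times> SC_left K"
    unfolding eq_left_def by blast
  show "refl_on (SC_left K) (eq_left K)"
    unfolding eq_left_def refl_on_def valid1_Iff1 by blast
  show "sym (eq_left K)"
    unfolding eq_left_def sym_def valid1_Iff1 by blast
  show "trans (eq_left K)"
    unfolding eq_left_def trans_def valid1_Iff1 by blast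
qed

lemma cls_left_self: "x \<in> SC_left K \<Longrightarrow> x \<in> cls_left K x"
  unfolding cls_left_def by (rule equiv_class_self[OF equiv_eq_left])

lemma cls_left_D:
  "(a, c) \<in> cls_left K (\<phi>, \<psi>) \<Longrightarrow> valid1 K (Iff1 \<phi> a)"
  unfolding cls_left_def eq_left_def by blast

lemma cls_left_eqI:
  assumes "valid1 K (Iff1 a b)"
  shows "cls_left K (a, WBox_o a) = cls_left K (b, WBox_o b)"
proof -
  have "(c, WBox_o c) \<in> SC_left K" for c
    unfolding SC_left_def valid2_Iff2 by blast
  then show ?thesis
    unfolding cls_left_def using assms
    by (intro equiv_class_eq[OF equiv_eq_left]) (unfold eq_left_def, blast)
qed

lemma meet_left_cls:
  assumes "(\<phi>, \<psi>) \<in> SC_left K" "(\<phi>', \<psi>') \<in> SC_left K"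
  shows "meet_left K (cls_left K (\<phi>, \<psi>)) (cls_left K (\<phi>', \<psi>')) =
    cls_left K (And1 \<phi> \<phi>', WBox_o (And1 \<phi> \<phi>'))"
proof -
  have "cls_left K (And1 a b, WBox_o (And1 a b)) =
      cls_left K (And1 \<phi> \<phi>', WBox_o (And1 \<phi> \<phi>'))"
    if "(a, c) \<in> cls_left K (\<phi>, \<psi>)" "(b, d) \<in> cls_left K (\<phi>', \<psi>')" for a b c d
    using that[THEN cls_left_D]
    by (intro cls_left_eqI) (unfold valid1_Iff1 sat1.simps, blast)
  then show ?thesis
    unfolding meet_left_def using assms[THEN cls_left_self] by blast
qed

lemma neg_left_cls:
  assumes "(\<phi>, \<psi>) \<in> SC_left K"
  shows "neg_left K (cls_left K (\<phi>, \<psi>)) = cls_left K (Neg1 \<phi>, WBox_o (Neg1 \<phi>))"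
proof -
  have "cls_left K (Neg1 a, WBox_o (Neg1 a)) =
      cls_left K (Neg1 \<phi>, WBox_o (Neg1 \<phi>))"
    if "(a, c) \<in> cls_left K (\<phi>, \<psi>)" for a c
    using that[THEN cls_left_D]
    by (intro cls_left_eqI) (unfold valid1_Iff1 sat1.simps, blast)
  then show ?thesis
    unfolding neg_left_def using assms[THEN cls_left_self] by blast
qed

lemma equiv_eq_right: "equiv (SC_right K) (eq_right K)"
proof (rule equivI)
  show "eq_right K \<subseteq> SC_right K \<times> SC_right K"
    unfolding eq_right_def by blast
  show "refl_on (SC_right K) (eq_right K)"
    unfolding eq_right_def refl_on_def valid2_Iff2 by blast
  show "sym (eq_right K)"
    unfolding eq_right_def sym_def valid2_Iff2 by blast
  show "trans (eq_right K)"
    unfolding eq_right_def trans_def valid2_Iff2 by blast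
qed

lemma cls_right_self: "x \<in> SC_right K \<Longrightarrow> x \<in> cls_right K x"
  unfolding cls_right_def by (rule equiv_class_self[OF equiv_eq_right])

lemma cls_right_D:
  "(a, c) \<in> cls_right K (\<phi>, \<psi>) \<Longrightarrow> valid2 K (Iff2 \<psi> c)"
  unfolding cls_right_def eq_right_def by blast

lemma cls_right_eqI:
  assumes "valid2 K (Iff2 a b)"
  shows "cls_right K (WBox_p a, a) = cls_right K (WBox_p b, b)"
proof -
  have "(WBox_p c, c) \<in> SC_right K" for c
    unfolding SC_right_def valid1_Iff1 by blast
  then show ?thesis
    unfolding cls_right_def using assms
    by (intro equiv_class_eq[OF equiv_eq_right]) (unfold eq_right_def, blast)
qed

lemma join_right_cls:
  assumes "(\<phi>, \<psi>) \<in> SC_right K" "(\<phi>', \<psi>') \<in> SC_right K"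
  shows "join_right K (cls_right K (\<phi>, \<psi>)) (cls_right K (\<phi>', \<psi>')) =
    cls_right K (WBox_p (And2 \<psi> \<psi>'), And2 \<psi> \<psi>')"
proof -
  have "cls_right K (WBox_p (And2 c d), And2 c d) =
      cls_right K (WBox_p (And2 \<psi> \<psi>'), And2 \<psi> \<psi>')"
    if "(a, c) \<in> cls_right K (\<phi>, \<psi>)" "(b, d) \<in> cls_right K (\<phi>', \<psi>')" for a b c d
    using that[THEN cls_right_D]
    by (intro cls_right_eqI) (unfold valid2_Iff2 sat2.simps, blast)
  then show ?thesis
    unfolding join_right_def using assms[THEN cls_right_self] by blast
qed

lemma neg_right_cls:
  assumes "(\<phi>, \<psi>) \<in> SC_right K"
  shows "neg_right K (cls_right K (\<phi>, \<psi>)) = cls_right K (WBox_p (Neg2 \<psi>), Neg2 \<psi>)"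
proof -
  have "cls_right K (WBox_p (Neg2 c), Neg2 c) =
      cls_right K (WBox_p (Neg2 \<psi>), Neg2 \<psi>)"
    if "(a, c) \<in> cls_right K (\<phi>, \<psi>)" for a c
    using that[THEN cls_right_D]
    by (intro cls_right_eqI) (unfold valid2_Iff2 sat2.simps, blast)
  then show ?thesis
    unfolding neg_right_def using assms[THEN cls_right_self] by blast
qed


section \<open>Boolean algebras on a carrier set\<close>

text \<open>The library's Boolean algebras live on whole types, whereas the quotients above depend on
  the context. The one-element Boolean algebra is allowed, since \<open>Obj K\<close> or \<open>Att K\<close> may be
  empty.\<close>

locale boolean_algebra_on =
  fixes B :: "'a set"
    and meet :: "'a \<Rightarrow> 'a \<Rightarrow> 'a"
    and join :: "'a \<Rightarrow> 'a \<Rightarrow> 'a"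
    and compl :: "'a \<Rightarrow> 'a"
    and bt :: 'a
    and tp :: 'a
  assumes meet_closed: "\<lbrakk>x \<in> B; y \<in> B\<rbrakk> \<Longrightarrow> meet x y \<in> B"
    and join_closed: "\<lbrakk>x \<in> B; y \<in> B\<rbrakk> \<Longrightarrow> join x y \<in> B"
    and compl_closed: "x \<in> B \<Longrightarrow> compl x \<in> B"
    and bt_closed: "bt \<in> B"
    and tp_closed: "tp \<in> B"
    and meet_assoc: "\<lbrakk>x \<in> B; y \<in> B; z \<in> B\<rbrakk> \<Longrightarrow> meet (meet x y) z = meet x (meet y z)"
    and join_assoc: "\<lbrakk>x \<in> B; y \<in> B; z \<in> B\<rbrakk> \<Longrightarrow> join (join x y) z = join x (join y z)"
    and meet_commute: "\<lbrakk>x \<in> B; y \<in> B\<rbrakk> \<Longrightarrow> meet x y = meet y x"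
    and join_commute: "\<lbrakk>x \<in> B; y \<in> B\<rbrakk> \<Longrightarrow> join x y = join y x"
    and meet_join_absorb: "\<lbrakk>x \<in> B; y \<in> B\<rbrakk> \<Longrightarrow> meet x (join x y) = x"
    and join_meet_absorb: "\<lbrakk>x \<in> B; y \<in> B\<rbrakk> \<Longrightarrow> join x (meet x y) = x"
    and meet_join_distrib:
      "\<lbrakk>x \<in> B; y \<in> B; z \<in> B\<rbrakk> \<Longrightarrow> meet x (join y z) = join (meet x y) (meet x z)"
    and join_meet_distrib:
      "\<lbrakk>x \<in> B; y \<in> B; z \<in> B\<rbrakk> \<Longrightarrow> join x (meet y z) = meet (join x y) (join x z)"
    and join_bt: "x \<in> B \<Longrightarrow> join x bt = x"
    and meet_tp: "x \<in> B \<Longrightarrow> meet x tp = x"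
    and meet_compl: "x \<in> B \<Longrightarrow> meet x (compl x) = bt"
    and join_compl: "x \<in> B \<Longrightarrow> join x (compl x) = tp"

end

theory Submission
  imports Defs
begin

text \<open>A left semiconcept is determined up to \<open>\<equiv>\<close> by its first component, so its class can be
  represented by \<open>(\<phi>, \<boxminus>\<phi>)\<close>, and the quotient is the Lindenbaum algebra of sort 1, i.e. an algebra
  of sets of points (model, object) under intersection and complement. Right semiconcepts are
  likewise determined by their second component, but their join is conjunction there, so their
  quotient is the order dual of the Lindenbaum algebra of sort 2.\<close>

text \<open>The axioms of \<open>boolean_algebra_on\<close> come in dual pairs, so exchanging the
  two operations and the two constants only permutes them. This serves the right semiconcepts, where
  conjunction acts as join.\<close>

lemma boolean_algebra_on_dual:
  assumes "boolean_algebra_on B meet join compl bt tp"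
  shows "boolean_algebra_on B join meet compl tp bt"
proof -
  interpret boolean_algebra_on B meet join compl bt tp
    by (fact assms)
  show ?thesis
    by unfold_locales
      (fact meet_closed join_closed compl_closed bt_closed tp_closed meet_assoc join_assoc
        meet_commute join_commute meet_join_absorb join_meet_absorb meet_join_distrib
        join_meet_distrib join_bt meet_tp meet_compl join_compl)+
qed

text \<open>Every element is the class of a formula and the operations act on representatives, so
  each law becomes an equation \<open>cls a = cls b\<close>. By \<open>cls_eqI\<close> it suffices
  that \<open>a\<close> and \<open>b\<close> agree at every point of \<open>S\<close>, which is a
  propositional tautology. Leaving \<open>cls\<close> and \<open>sem\<close> abstract lets one
  argument serve both sorts.\<close>

lemma boolean_algebra_on_Lindenbaum:
  fixes cls :: "'f \<Rightarrow> 'a" and sem :: "'f \<Rightarrow> 's \<Rightarrow> bool"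
  assumes carrier: "B = range cls"
    and meet: "\<And>a b. meet (cls a) (cls b) = cls (cj a b)"
    and compl: "\<And>a. compl (cls a) = cls (ng a)"
    and bt: "bt = cls fls"
    and cls_eqI: "\<And>a b. (\<And>s. s \<in> S \<Longrightarrow> sem a s \<longleftrightarrow> sem b s) \<Longrightarrow> cls a = cls b"
    and sem_cj: "\<And>a b s. sem (cj a b) s \<longleftrightarrow> sem a s \<and> sem b s"
    and sem_ng: "\<And>a s. sem (ng a) s \<longleftrightarrow> \<not> sem a s"
    and sem_fls: "\<And>s. \<not> sem fls s"
  shows "boolean_algebra_on B meet (\<lambda>x y. compl (meet (compl x) (compl y))) compl bt (compl bt)"
  unfolding carrier bt
  by unfold_locales
    (auto simp: meet compl sem_cj sem_ng sem_fls intro!: cls_eqI)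

lemma left_semiconcept_WBox_o: "(\<phi>, WBox_o \<phi>) \<in> SC_left K"
  unfolding SC_left_def valid2_Iff2 by blast

lemma right_semiconcept_WBox_p: "(WBox_p \<psi>, \<psi>) \<in> SC_right K"
  unfolding SC_right_def valid1_Iff1 by blast

text \<open>The relation \<open>eq_left\<close> compares first components only, so changing the
  second component within \<open>SC_left K\<close> does not change the class.\<close>

lemma cls_left_eq_WBox_o:
  assumes "(\<phi>, \<psi>) \<in> SC_left K"
  shows "cls_left K (\<phi>, \<psi>) = cls_left K (\<phi>, WBox_o \<phi>)"
  unfolding cls_left_def using assms left_semiconcept_WBox_o[of \<phi> K]
  by (intro equiv_class_eq[OF equiv_eq_left]) (auto simp: eq_left_def valid1_Iff1)

lemma cls_right_eq_WBox_p:
  assumes "(\<phi>, \<psi>) \<in> SC_right K"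
  shows "cls_right K (\<phi>, \<psi>) = cls_right K (WBox_p \<psi>, \<psi>)"
  unfolding cls_right_def using assms right_semiconcept_WBox_p[of \<psi> K]
  by (intro equiv_class_eq[OF equiv_eq_right]) (auto simp: eq_right_def valid2_Iff2)

text \<open>Indexing the classes by single formulas gives the carrier the shape that
  \<open>boolean_algebra_on_Lindenbaum\<close> asks for.\<close>

lemma quotient_left_eq_range:
  "SC_left K // eq_left K = range (\<lambda>\<phi>. cls_left K (\<phi>, WBox_o \<phi>))"
proof (rule set_eqI, rule iffI)
  fix X assume "X \<in> SC_left K // eq_left K"
  then obtain \<phi> \<psi> where "(\<phi>, \<psi>) \<in> SC_left K" "X = cls_left K (\<phi>, \<psi>)"
    unfolding cls_left_def by (force elim: quotientE)
  then show "X \<in> range (\<lambda>\<phi>. cls_left K (\<phi>, WBox_o \<phi>))"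
    using cls_left_eq_WBox_o by blast
next
  fix X assume "X \<in> range (\<lambda>\<phi>. cls_left K (\<phi>, WBox_o \<phi>))"
  then show "X \<in> SC_left K // eq_left K"
    unfolding cls_left_def by (auto intro: quotientI left_semiconcept_WBox_o)
qed

lemma quotient_right_eq_range:
  "SC_right K // eq_right K = range (\<lambda>\<psi>. cls_right K (WBox_p \<psi>, \<psi>))"
proof (rule set_eqI, rule iffI)
  fix X assume "X \<in> SC_right K // eq_right K"
  then obtain \<phi> \<psi> where "(\<phi>, \<psi>) \<in> SC_right K" "X = cls_right K (\<phi>, \<psi>)"
    unfolding cls_right_def by (force elim: quotientE)
  then show "X \<in> range (\<lambda>\<psi>. cls_right K (WBox_p \<psi>, \<psi>))"
    using cls_right_eq_WBox_p by blast
next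
  fix X assume "X \<in> range (\<lambda>\<psi>. cls_right K (WBox_p \<psi>, \<psi>))"
  then show "X \<in> SC_right K // eq_right K"
    unfolding cls_right_def by (auto intro: quotientI right_semiconcept_WBox_p)
qed

lemma boolean_algebra_on_left:
  "boolean_algebra_on (SC_left K // eq_left K) (meet_left K)
    (\<lambda>X Y. neg_left K (meet_left K (neg_left K X) (neg_left K Y)))
    (neg_left K) (bot_left K) (neg_left K (bot_left K))"
  \<comment> \<open>A point is a valuation together with an object, so agreement of two formulas on
    \<open>S\<close> is exactly validity of their biconditional. \<open>Bot1\<close> fails at every
    point, whichever variable it is built from.\<close>
  by (rule boolean_algebra_on_Lindenbaum
      [where cls = "\<lambda>\<phi>. cls_left K (\<phi>, WBox_o \<phi>)" and cj = And1 and ng = Neg1 and fls = Bot1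
        and sem = "\<lambda>\<phi> (v, w, g). sat1 K v w \<phi> g"
        and S = "{(v, w, g). valuation K v w \<and> g \<in> Obj K}"])
    (auto simp: quotient_left_eq_range meet_left_cls neg_left_cls left_semiconcept_WBox_o
      bot_left_def Bot1_def valid1_Iff1 intro!: cls_left_eqI)

text \<open>Taking \<open>And2\<close> as meet and the class of \<open>Bot2\<close> as least element
  gives the Lindenbaum algebra of sort 2. Dualizing it turns \<open>join_right\<close> into the join
  and \<open>top_right\<close> into the greatest element.\<close>

lemma boolean_algebra_on_right:
  "boolean_algebra_on (SC_right K // eq_right K)
    (\<lambda>X Y. neg_right K (join_right K (neg_right K X) (neg_right K Y)))
    (join_right K) (neg_right K) (neg_right K (top_right K)) (top_right K)"
  by (rule boolean_algebra_on_dual, rule boolean_algebra_on_Lindenbaum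
      [where cls = "\<lambda>\<psi>. cls_right K (WBox_p \<psi>, \<psi>)" and cj = And2 and ng = Neg2 and fls = Bot2
        and sem = "\<lambda>\<psi> (v, w, m). sat2 K v w \<psi> m"
        and S = "{(v, w, m). valuation K v w \<and> m \<in> Att K}"])
    (auto simp: quotient_right_eq_range join_right_cls neg_right_cls right_semiconcept_WBox_p
      top_right_def Bot2_def valid2_Iff2 intro!: cls_right_eqI)

theorem theorem5p1:
  fixes K :: "('g, 'm) fcontext"
  assumes "is_fcontext K"
  shows
    "boolean_algebra_on
        ((SC_left K :: (('p, 'q) fm1 \<times> ('p, 'q) fm2) set) // eq_left K)
        (meet_left K)
        (\<lambda>X Y. neg_left K (meet_left K (neg_left K X) (neg_left K Y)))
        (neg_left K)
        (bot_left K)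
        (neg_left K (bot_left K))
     \<and>
     boolean_algebra_on
        ((SC_right K :: (('p, 'q) fm1 \<times> ('p, 'q) fm2) set) // eq_right K)
        (\<lambda>X Y. neg_right K (join_right K (neg_right K X) (neg_right K Y)))
        (join_right K)
        (neg_right K)
        (neg_right K (top_right K))
        (top_right K)"
  using boolean_algebra_on_left boolean_algebra_on_right by (rule conjI)

end
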